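(* Assume there exist vectors $\bar y_k\in\mathcal{Y}_k$ ($k=1,\dots,K$) and $\bar q_j\in\triangle$ ($j=1,\dots,J$) with $\sum_{k=1}^K \bar y_k>\sum_{j=1}^J\mathcal{N}_j\bar q_j$ componentwise. Let $p_0\in\mathbb{R}^n_+$, let $$0<h\le\frac{1}{\sum_{j=1}^{J}\frac{\mathcal{N}_j}{\beta_j}+\sum_{k=1}^{K}\frac{1}{\Gamma_k}},\qquad \beta_j=\min_{1\le\ell\le L_j}\mu_{j\ell},$$ and for $t=0,1,2,\dots$ define $$p_{t+1}=\left[p_t-h\cdot\left(\sum_{k=1}^{K}y_k(p_t)-\sum_{j=1}^{J}\mathcal{N}_j\,x_j(p_t)\right)\right]_+ .$$ Then the sequence $(p_t)_{t\ge 0}$ converges to an equilibrium price $p^\star$. Moreover, for all $t\ge 1$, $$TER(p_t)-TER(p^\star)\le\frac{\|p_0-p^\star\|_2^2}{2th}.$$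
   Context: $\langle\cdot,\cdot\rangle$ is the standard inner product on $\mathbb{R}^n$; inequalities between vectors are componentwise; $\mathbb{R}^n_+$ is the nonnegative orthant; $[x]_+$ is the componentwise positive part $\max\{x,0\}$; $\triangle=\{q\in\mathbb{R}^n: q^{(i)}\ge 0,\ \sum_{i=1}^n q^{(i)}=1\}$. Demand. There are $n$ products and $J$ types of consumers, with $\mathcal{N}_j>0$ consumers of type $j$. For type $j$ there is a vector of observable utilities $a_j\in\mathbb{R}^n$, a partition of $\{1,\dots,n\}$ into nonempty nests $N_{j1},\dots,N_{jL_j}$, and nest parameters $0<\mu_{j\ell}\le 1$. The expected revenue (nested logit surplus) of a type-$j$ consumer at prices $p$ is $$E_j(p)=\ln\left(\sum_{\ell=1}^{L_j}\Big(\sum_{i\in N_{j\ell}}e^{(a_j^{(i)}-p^{(i)})/\mu_{j\ell}}\Big)^{\mu_{j\ell}}\right),$$ and the expected demand is $x_j(p)=-\nabla E_j(p)\in\triangle$ (the vector of choice probabilities). Supply. There are $K$ suppliers. Supplier $k$ has a closed convex set $\mathcal{Y}_k\subset\mathbb{R}^n$ and cost function $c_k(y)=\hat c_k(y)+\Gamma_k\|y-\hat y_k\|_2^2$, where $\hat c_k:\mathbb{R}^n\to\mathbb{R}$ is convex, $\Gamma_k>0$ and $\hat y_k\in\mathbb{R}^n$. Its profit is $\pi_k(p)=\max_{y\in\mathcal{Y}_k}\langle p,y\rangle-c_k(y)$, and its supply $y_k(p)$ is the unique maximizer. The total expected revenue function is $TER(p)=\sum_{k=1}^K\pi_k(p)+\sum_{j=1}^J\mathcal{N}_jE_j(p)$.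 A vector $p^\star\in\mathbb{R}^n$ is an equilibrium price if $p^\star\ge 0$, $\sum_{k=1}^K y_k(p^\star)-\sum_{j=1}^J\mathcal{N}_jx_j(p^\star)\ge 0$, and $\big\langle p^\star,\ \sum_{k=1}^K y_k(p^\star)-\sum_{j=1}^J\mathcal{N}_jx_j(p^\star)\big\rangle=0$. *)

theory Defs
  imports "HOL-Analysis.Analysis"
begin

text \<open>
  Products are indexed by a finite type \<open>'n\<close>. On \<open>real ^ 'n\<close> the library relation \<open>\<le>\<close> is
  componentwise, but \<open>x < y\<close> only means \<open>x \<le> y \<and> \<not> y \<le> x\<close>, so strict componentwise
  inequalities have to be spelled out.
\<close>

definition prob_simplex :: "(real ^ 'n) set" where
  "prob_simplex = {q. (\<forall>i. 0 \<le> q $ i) \<and> (\<Sum>i\<in>UNIV. q $ i) = 1}"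

definition pos_part :: "real ^ 'n \<Rightarrow> real ^ 'n" where
  "pos_part x = (\<chi> i. max (x $ i) 0)"

definition gradient :: "('a::real_inner \<Rightarrow> real) \<Rightarrow> 'a \<Rightarrow> 'a" where
  "gradient f x = (THE g. GDERIV f x :> g)"


subsection \<open>Demand\<close>

text \<open>
  One record describes one type of consumers; its nests are \<open>nest l\<close> with
  \<open>l \<in> {1..num_nests}\<close>.
\<close>

record ('n::finite) consumer_type =
  population :: real
  utility :: "real ^ 'n"
  num_nests :: nat
  nest :: "nat \<Rightarrow> 'n set"
  nest_param :: "nat \<Rightarrow> real"

definition valid_consumer :: "('n::finite) consumer_type \<Rightarrow> bool" where
  "valid_consumer C \<longleftrightarrow>
     population C > 0 \<and>
     (\<forall>l\<in>{1..num_nests C}. nest C l \<noteq> {}) \<and>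
     disjoint_family_on (nest C) {1..num_nests C} \<and>
     (\<Union>l\<in>{1..num_nests C}. nest C l) = UNIV \<and>
     (\<forall>l\<in>{1..num_nests C}. 0 < nest_param C l \<and> nest_param C l \<le> 1)"

definition expected_revenue :: "('n::finite) consumer_type \<Rightarrow> real ^ 'n \<Rightarrow> real" where
  "expected_revenue C p =
     ln (\<Sum>l=1..num_nests C.
           (\<Sum>i\<in>nest C l. exp ((utility C $ i - p $ i) / nest_param C l)) powr nest_param C l)"

definition demand :: "('n::finite) consumer_type \<Rightarrow> real ^ 'n \<Rightarrow> real ^ 'n" where
  "demand C p = - gradient (expected_revenue C) p"

definition min_nest_param :: "('n::finite) consumer_type \<Rightarrow> real" where
  "min_nest_param C = Min (nest_param C ` {1..num_nests C})"


subsection \<open>Supply\<close>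

record ('n::finite) supplier =
  capacity_set :: "(real ^ 'n) set"
  base_cost :: "real ^ 'n \<Rightarrow> real"
  reg_weight :: real
  reg_center :: "real ^ 'n"

definition valid_supplier :: "('n::finite) supplier \<Rightarrow> bool" where
  "valid_supplier S \<longleftrightarrow>
     closed (capacity_set S) \<and> convex (capacity_set S) \<and>
     convex_on UNIV (base_cost S) \<and> reg_weight S > 0"

definition cost :: "('n::finite) supplier \<Rightarrow> real ^ 'n \<Rightarrow> real" where
  "cost S y = base_cost S y + reg_weight S * (norm (y - reg_center S))\<^sup>2"

definition profit :: "('n::finite) supplier \<Rightarrow> real ^ 'n \<Rightarrow> real" where
  "profit S p = (GREATEST v. \<exists>y\<in>capacity_set S. v = p \<bullet> y - cost S y)"

definition optimal_supply :: "('n::finite) supplier \<Rightarrow> real ^ 'n \<Rightarrow> real ^ 'n" where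
  "optimal_supply S p = (THE y. is_arg_max (\<lambda>y. p \<bullet> y - cost S y) (\<lambda>y. y \<in> capacity_set S) y)"


subsection \<open>Market\<close>

text \<open>Suppliers are \<open>S 1, \<dots>, S K\<close> and consumer types are \<open>C 1, \<dots>, C J\<close>.\<close>

definition excess_supply ::
  "nat \<Rightarrow> (nat \<Rightarrow> ('n::finite) supplier) \<Rightarrow> nat \<Rightarrow> (nat \<Rightarrow> 'n consumer_type) \<Rightarrow> real ^ 'n \<Rightarrow> real ^ 'n" where
  "excess_supply K S J C p =
     (\<Sum>k=1..K. optimal_supply (S k) p) - (\<Sum>j=1..J. population (C j) *\<^sub>R demand (C j) p)"

definition total_expected_revenue ::
  "nat \<Rightarrow> (nat \<Rightarrow> ('n::finite) supplier) \<Rightarrow> nat \<Rightarrow> (nat \<Rightarrow> 'n consumer_type) \<Rightarrow> real ^ 'n \<Rightarrow> real" where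
  "total_expected_revenue K S J C p =
     (\<Sum>k=1..K. profit (S k) p) + (\<Sum>j=1..J. population (C j) * expected_revenue (C j) p)"

definition equilibrium_price ::
  "nat \<Rightarrow> (nat \<Rightarrow> ('n::finite) supplier) \<Rightarrow> nat \<Rightarrow> (nat \<Rightarrow> 'n consumer_type) \<Rightarrow> real ^ 'n \<Rightarrow> bool" where
  "equilibrium_price K S J C p \<longleftrightarrow>
     0 \<le> p \<and> 0 \<le> excess_supply K S J C p \<and> p \<bullet> excess_supply K S J C p = 0"

end

(*
  The total expected revenue f is convex and its gradient is the excess supply; the price
  adjustment is projected gradient descent on the nonnegative orthant. Two-sided quadratic bounds
    f x + <g x, y - x> \<le> f y \<le> f x + <g x, y - x> + L/2 |y - x|^2
  already force g to be the gradient of f and are additive, so it suffices to show them for each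
  consumer and each supplier. For the nested logit surplus the lower bound is Jensen's inequality
  and the upper bound Hoeffding's lemma, each applied first within the nests and then across them;
  for the profit both come from optimality and the quadratic growth of the strongly convex cost.
  The Slater-type assumption bounds f below by an affine function with positive slopes, so f has
  a minimizer on the orthant. The iterates are Fejer monotone with respect to the set of minimizers and
  f (p t) tends to the minimum at rate 1/t, so a cluster point is a minimizer and the whole sequence
  converges to it. A minimizer is a fixed point of the projected step, which is exactly
  complementarity.
*)
theory Submission
  imports Defs "HOL-Probability.Hoeffding"
begin

section \<open>Two-sided quadratic bounds and the gradient they determine\<close>

section \<open>Smooth convex functions\<close>

text \<open>The lower half is convexity with \<open>g x\<close> as subgradient; the upper half is
  the descent inequality of an \<open>L\<close>-Lipschitz gradient. With \<open>g\<close> a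
  parameter, differentiability becomes a consequence (\<open>convex_smooth_GDERIV\<close>) instead
  of a premise.\<close>

definition convex_smooth :: "('a::real_inner \<Rightarrow> real) \<Rightarrow> ('a \<Rightarrow> 'a) \<Rightarrow> real \<Rightarrow> bool" where
  "convex_smooth f g L \<longleftrightarrow>
     (\<forall>x y. f x + g x \<bullet> (y - x) \<le> f y \<and>
            f y \<le> f x + g x \<bullet> (y - x) + L / 2 * (norm (y - x))\<^sup>2)"

lemma convex_smooth_lower: "convex_smooth f g L \<Longrightarrow> f x + g x \<bullet> (y - x) \<le> f y"
  by (simp add: convex_smooth_def)

lemma convex_smooth_upper:
  "convex_smooth f g L \<Longrightarrow> f y \<le> f x + g x \<bullet> (y - x) + L / 2 * (norm (y - x))\<^sup>2"
  by (simp add: convex_smooth_def)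

lemma convex_smooth_add:
  assumes "convex_smooth f g L" "convex_smooth f' g' L'"
  shows "convex_smooth (\<lambda>x. f x + f' x) (\<lambda>x. g x + g' x) (L + L')"
  unfolding convex_smooth_def
proof (intro allI)
  fix x y
  show "f x + f' x + (g x + g' x) \<bullet> (y - x) \<le> f y + f' y \<and>
        f y + f' y \<le> f x + f' x + (g x + g' x) \<bullet> (y - x) + (L + L') / 2 * (norm (y - x))\<^sup>2"
    using convex_smooth_lower[OF assms(1), of x y] convex_smooth_lower[OF assms(2), of x y]
      convex_smooth_upper[OF assms(1), of y x] convex_smooth_upper[OF assms(2), of y x]
    by (simp add: inner_add_left add_divide_distrib distrib_right)
qed

lemma convex_smooth_cmult:
  assumes "convex_smooth f g L" "0 \<le> c"
  shows "convex_smooth (\<lambda>x. c * f x) (\<lambda>x. c *\<^sub>R g x) (c * L)"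
  unfolding convex_smooth_def
proof (intro allI)
  fix x y
  show "c * f x + (c *\<^sub>R g x) \<bullet> (y - x) \<le> c * f y \<and>
        c * f y \<le> c * f x + (c *\<^sub>R g x) \<bullet> (y - x) + c * L / 2 * (norm (y - x))\<^sup>2"
    using mult_left_mono[OF convex_smooth_lower[OF assms(1), of x y] assms(2)]
      mult_left_mono[OF convex_smooth_upper[OF assms(1), of y x] assms(2)]
    by (simp add: distrib_left mult.assoc)
qed

lemma convex_smooth_sum:
  assumes "finite A" "\<And>k. k \<in> A \<Longrightarrow> convex_smooth (f k) (g k) (L k)"
  shows "convex_smooth (\<lambda>x. \<Sum>k\<in>A. f k x) (\<lambda>x. \<Sum>k\<in>A. g k x) (\<Sum>k\<in>A. L k)"
  using assms
proof (induction A rule: finite_induct)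
  case empty
  then show ?case by (simp add: convex_smooth_def)
next
  case (insert a A)
  then show ?case using convex_smooth_add[of "f a" "g a" "L a"] by simp
qed

text \<open>The linearization error lies between 0 and
  \<open>L / 2 * (norm (y - x))\<^sup>2\<close>, so it tends to 0 even after division by
  \<open>norm (y - x)\<close>.\<close>

lemma convex_smooth_GDERIV:
  assumes "convex_smooth f g L"
  shows "GDERIV f x :> g x"
  unfolding gderiv_def has_derivative_iff_norm
proof (intro conjI)
  show "bounded_linear (\<lambda>h. h \<bullet> g x)" by (rule bounded_linear_inner_left)
  have bd: "norm (norm (f y - f x - (y - x) \<bullet> g x) / norm (y - x)) \<le> L / 2 * norm (y - x)" for y
  proof (cases "y = x")
    case False
    then have "0 < norm (y - x)" by simp
    then show ?thesis
      using convex_smooth_lower[OF assms, of x y] convex_smooth_upper[OF assms, of y x]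
      by (simp add: inner_commute field_simps power2_eq_square)
  qed simp
  have "((\<lambda>y. L / 2 * norm (y - x)) \<longlongrightarrow> L / 2 * norm (x - x)) (at x)"
    by (intro tendsto_intros)
  then have lim: "((\<lambda>y. L / 2 * norm (y - x)) \<longlongrightarrow> 0) (at x)" by simp
  show "((\<lambda>y. norm (f y - f x - (y - x) \<bullet> g x) / norm (y - x)) \<longlongrightarrow> 0) (at x)"
    by (rule Lim_null_comparison[OF _ lim]) (use bd in simp)
qed

lemma convex_smooth_continuous_on:
  assumes "convex_smooth f g L"
  shows "continuous_on A f"
  using convex_smooth_GDERIV[OF assms] unfolding gderiv_def
  by (meson continuous_at_imp_continuous_on has_derivative_continuous)

text \<open>Evaluating the definite description in \<open>gradient\<close> takes uniqueness: the
  derivative fixes the functional \<open>\<lambda>h. h \<bullet> D\<close>, and this fixes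
  \<open>D\<close>.\<close>

lemma gradient_eqI:
  assumes "GDERIV f x :> D"
  shows "gradient f x = D"
  unfolding gradient_def
proof (rule the_equality, rule assms)
  fix D' assume "GDERIV f x :> D'"
  then have "(\<lambda>h. h \<bullet> D') = (\<lambda>h. h \<bullet> D)"
    using assms unfolding gderiv_def by (rule has_derivative_unique)
  then have "\<forall>h. h \<bullet> D' = h \<bullet> D" by meson
  then show "D' = D" by (simp only: vector_eq_ldot)
qed

section \<open>One-step estimate, rate and convergence of the projected iteration\<close>

section \<open>Projected gradient descent on the nonnegative orthant\<close>

lemma pos_part_nonneg: "0 \<le> pos_part x"
  by (simp add: pos_part_def less_eq_vec_def)

text \<open>Variational inequality of the Euclidean projection onto the orthant. In each coordinate
  either the first factor vanishes, or it is negative and the second factor is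
  \<open>z $ i\<close>.\<close>

lemma pos_part_projection:
  assumes "0 \<le> z"
  shows "(u - pos_part u) \<bullet> (z - pos_part u) \<le> 0"
proof -
  have "(u $ i - max (u $ i) 0) * (z $ i - max (u $ i) 0) \<le> 0" for i
    using assms by (auto simp: less_eq_vec_def max_def mult_nonpos_nonneg)
  then show ?thesis
    by (auto simp: inner_vec_def pos_part_def intro!: sum_nonpos)
qed

text \<open>The upper bound at \<open>x\<close> controls \<open>f x'\<close>, the lower bound at
  \<open>x\<close> controls \<open>f z\<close>, and \<open>L * h \<le> 1\<close> lets squared
  distances absorb the quadratic term. Taking \<open>z\<close> as the current point, a minimizer or
  any point of the orthant yields descent, Fejer monotonicity and the rate.\<close>

lemma projected_step:
  fixes g :: "real ^ 'n::finite \<Rightarrow> real ^ 'n"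
  assumes f: "convex_smooth f g L" and h: "0 < h" "L * h \<le> 1" and z: "0 \<le> z"
    and x': "x' = pos_part (x - h *\<^sub>R g x)"
  shows "2 * h * (f x' - f z) \<le> (norm (x - z))\<^sup>2 - (norm (x' - z))\<^sup>2"
proof -
  have "f x' - f z \<le> g x \<bullet> (x' - z) + L / 2 * (norm (x' - x))\<^sup>2"
    using convex_smooth_lower[OF f, of x z] convex_smooth_upper[OF f, of x' x]
    by (simp add: inner_diff_right)
  then have "2 * h * (f x' - f z) \<le> 2 * h * (g x \<bullet> (x' - z) + L / 2 * (norm (x' - x))\<^sup>2)"
    using h by (intro mult_left_mono) auto
  also have "\<dots> = 2 * h * (g x \<bullet> (x' - z)) + (L * h) * (norm (x' - x))\<^sup>2"
    by (simp add: algebra_simps)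
  also have "\<dots> \<le> 2 * h * (g x \<bullet> (x' - z)) + 1 * (norm (x' - x))\<^sup>2"
    using h by (intro add_left_mono mult_right_mono) auto
  \<comment> \<open>The projection inequality for \<open>x - h *\<^sub>R g x\<close> reads \<open>h
    * (g x \<bullet> (x' - z)) \<le> (x - x') \<bullet> (x' - z)\<close>.\<close>
  also have "\<dots> \<le> 2 * ((x - x') \<bullet> (x' - z)) + (norm (x' - x))\<^sup>2"
    using pos_part_projection[OF z, of "x - h *\<^sub>R g x"]
    unfolding x'[symmetric] by (simp add: inner_diff_left inner_diff_right inner_commute algebra_simps)
  also have "\<dots> = (norm (x - z))\<^sup>2 - (norm (x' - z))\<^sup>2"
    by (simp add: power2_norm_eq_inner inner_diff_left inner_diff_right inner_commute)
  finally show ?thesis .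
qed

text \<open>Each coordinate equation leaves two cases: \<open>x $ i = 0\<close> with
  \<open>v $ i \<ge> 0\<close>, or \<open>x $ i > 0\<close> with \<open>v $ i = 0\<close>. For
  \<open>v\<close> the excess supply these are the equilibrium conditions.\<close>

lemma pos_part_fixed_point_complementarity:
  assumes h: "0 < h" and x: "pos_part (x - h *\<^sub>R v) = x"
  shows "0 \<le> v" "x \<bullet> v = 0"
proof -
  have eq: "max (x $ i - h * v $ i) 0 = x $ i" for i
    using arg_cong[OF x, of "\<lambda>y. y $ i"] by (simp add: pos_part_def)
  have v: "0 \<le> v $ i" and xv: "x $ i * v $ i = 0" for i
  proof -
    have "0 \<le> x $ i" using eq[of i] by linarith
    moreover have "0 \<le> h * v $ i" using eq[of i] by linarith
    ultimately show "0 \<le> v $ i" using h by (simp add: zero_le_mult_iff)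
    have "x $ i = 0 \<or> h * v $ i = 0" using eq[of i] by linarith
    then show "x $ i * v $ i = 0" using h by auto
  qed
  from v show "0 \<le> v" by (simp add: less_eq_vec_def)
  show "x \<bullet> v = 0" unfolding inner_vec_def inner_real_def by (intro sum.neutral ballI xv)
qed

lemma closed_nonneg_orthant: "closed {x :: real ^ 'n. 0 \<le> x}"
  unfolding less_eq_vec_def by (intro closed_Collect_all closed_Collect_le continuous_intros)

text \<open>Positive slopes bound every coordinate on the sublevel set of \<open>f 0\<close> by
  \<open>(f 0 - c) / d $ i\<close>, so that set is compact.\<close>

lemma orthant_minimizer_exists:
  fixes f :: "real ^ 'n::finite \<Rightarrow> real"
  assumes cont: "continuous_on UNIV f"
    and lower: "\<And>x. 0 \<le> x \<Longrightarrow> c + x \<bullet> d \<le> f x"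
    and d: "\<And>i. 0 < d $ i"
  obtains m where "0 \<le> m" "\<And>z. 0 \<le> z \<Longrightarrow> f m \<le> f z"
proof -
  let ?A = "{x. 0 \<le> x} \<inter> {x. f x \<le> f 0}"
  have "closed ?A"
    by (intro closed_Int closed_nonneg_orthant closed_Collect_le cont continuous_intros)
  moreover have "bounded ?A"
  proof (rule boundedI)
    fix x assume "x \<in> ?A"
    then have x: "0 \<le> x $ i" "f x \<le> f 0" "0 \<le> x" for i by (auto simp: less_eq_vec_def)
    have "\<bar>x $ i\<bar> \<le> (f 0 - c) / d $ i" for i
    proof -
      have "x $ i * d $ i \<le> x \<bullet> d"
        unfolding inner_vec_def inner_real_def
        by (rule member_le_sum) (use x d in \<open>auto simp: less_imp_le\<close>)
      also have "\<dots> \<le> f 0 - c" using lower[OF x(3)] x(2) by simp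
      finally show ?thesis using d[of i] x(1)[of i] by (simp add: field_simps)
    qed
    then have "(\<Sum>i\<in>UNIV. \<bar>x $ i\<bar>) \<le> (\<Sum>i\<in>UNIV. (f 0 - c) / d $ i)" by (intro sum_mono)
    with norm_le_l1_cart[of x] show "norm x \<le> (\<Sum>i\<in>UNIV. (f 0 - c) / d $ i)" by linarith
  qed
  ultimately have "compact ?A" by (simp add: compact_eq_bounded_closed)
  moreover have "?A \<noteq> {}" by auto
  ultimately have "\<exists>m\<in>?A. \<forall>y\<in>?A. f m \<le> f y"
    by (rule continuous_attains_inf[OF _ _ continuous_on_subset[OF cont subset_UNIV]])
  then obtain m where m: "m \<in> ?A" "\<forall>y\<in>?A. f m \<le> f y" by blast
  have "f m \<le> f z" if "0 \<le> z" for z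
  proof (cases "f z \<le> f 0")
    case True
    then show ?thesis using m(2) that by auto
  next
    case False
    then show ?thesis using m(1) by auto
  qed
  then show thesis using m(1) that by auto
qed

text \<open>\<open>m\<close> witnesses that the minimum is attained; the limit \<open>x\<close>
  arises as a cluster point and may be a different minimizer.\<close>

lemma projected_gradient_descent:
  fixes f :: "real ^ 'n::finite \<Rightarrow> real" and p :: "nat \<Rightarrow> real ^ 'n"
  assumes f: "convex_smooth f g L" and h: "0 < h" "L * h \<le> 1"
    and p0: "0 \<le> p 0" and step: "\<And>t. p (Suc t) = pos_part (p t - h *\<^sub>R g (p t))"
    and m: "0 \<le> m" "\<And>z. 0 \<le> z \<Longrightarrow> f m \<le> f z"
  obtains x where "p \<longlonglongrightarrow> x" "pos_part (x - h *\<^sub>R g x) = x"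
    "\<And>t. 1 \<le> t \<Longrightarrow> f (p t) - f x \<le> (norm (p 0 - x))\<^sup>2 / (2 * real t * h)"
proof -
  have p: "0 \<le> p t" for t
    by (cases t) (auto simp: p0 step pos_part_nonneg)
  note desc = projected_step[OF f h _ step]
  have mono: "f (p (Suc t)) \<le> f (p t)" for t
  proof -
    have "2 * h * (f (p (Suc t)) - f (p t)) \<le> 0"
      using desc[OF p[of t], of t] zero_le_power2[of "norm (p (Suc t) - p t)"]
      unfolding diff_self norm_zero zero_power2 by linarith
    then show ?thesis using h by (simp add: mult_le_0_iff)
  qed
  have dec: "decseq (\<lambda>t. f (p t))"
    using mono by (rule decseq_SucI)
  \<comment> \<open>Stated for every minimizer: \<open>m\<close> gives boundedness of the iterates,
    and the cluster point later gives convergence.\<close>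
  have fejer: "(norm (p (Suc t) - x))\<^sup>2 \<le> (norm (p t - x))\<^sup>2"
    if x: "0 \<le> x" "f x \<le> f m" for t x
  proof -
    have "f x \<le> f (p (Suc t))" using x m(2)[OF p[of "Suc t"]] by linarith
    then have "0 \<le> 2 * h * (f (p (Suc t)) - f x)" using h by auto
    then show ?thesis using desc[OF x(1), of t] by linarith
  qed
  have rate: "2 * h * (real t * (f (p t) - f x)) \<le> (norm (p 0 - x))\<^sup>2 - (norm (p t - x))\<^sup>2"
    if x: "0 \<le> x" for t x
  proof (induction t)
    case (Suc t)
    \<comment> \<open>By monotonicity the latest value may replace the \<open>t\<close> earlier
      ones, so the one-step estimates telescope.\<close>
    have "real t * f (p (Suc t)) \<le> real t * f (p t)"
      using mono[of t] by (rule mult_left_mono) simp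
    then have "real (Suc t) * (f (p (Suc t)) - f x)
        \<le> real t * (f (p t) - f x) + (f (p (Suc t)) - f x)"
      by (simp add: algebra_simps)
    then have "2 * h * (real (Suc t) * (f (p (Suc t)) - f x))
        \<le> 2 * h * (real t * (f (p t) - f x) + (f (p (Suc t)) - f x))"
      using h by (intro mult_left_mono) auto
    then show ?case using Suc desc[OF x, of t] by (simp add: distrib_left)
  qed simp
  have rate': "f (p t) - f x \<le> (norm (p 0 - x))\<^sup>2 / (2 * real t * h)"
    if x: "0 \<le> x" and t: "1 \<le> t" for t x
  proof -
    have "2 * h * (real t * (f (p t) - f x)) \<le> (norm (p 0 - x))\<^sup>2"
      using rate[OF x, of t] zero_le_power2[of "norm (p t - x)"] by linarith
    then show ?thesis using t h by (simp add: field_simps)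
  qed
  have bnd: "norm (p t) \<le> norm m + norm (p 0 - m)" for t
  proof -
    have "decseq (\<lambda>t. (norm (p t - m))\<^sup>2)" using fejer[OF m(1)] by (intro decseq_SucI) auto
    then have "(norm (p t - m))\<^sup>2 \<le> (norm (p 0 - m))\<^sup>2"
      by (simp add: decseq_def)
    then have "norm (p t - m) \<le> norm (p 0 - m)"
      by (rule power2_le_imp_le) simp
    then show ?thesis using norm_triangle_ineq2[of "p t" m] by linarith
  qed
  have "bounded (range p)" by (rule boundedI[of _ "norm m + norm (p 0 - m)"]) (use bnd in auto)
  then obtain x r where r: "strict_mono r" and sub: "(p \<circ> r) \<longlonglongrightarrow> x"
    using bounded_imp_convergent_subsequence by blast
  have x0: "0 \<le> x"
    using closed_sequentially[OF closed_nonneg_orthant _ sub] p by auto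
  \<comment> \<open>The rate against \<open>m\<close> along the subsequence: the right side tends to
    \<open>f m\<close>, so the cluster point is a minimizer.\<close>
  have "(\<lambda>t. f m + (norm (p 0 - m))\<^sup>2 / (2 * h) * inverse (real (r t))) \<longlonglongrightarrow>
      f m + (norm (p 0 - m))\<^sup>2 / (2 * h) * 0"
    using LIMSEQ_subseq_LIMSEQ[OF lim_inverse_n r] by (intro tendsto_intros) (simp add: o_def)
  moreover have "(\<lambda>t. f (p (r t))) \<longlonglongrightarrow> f x"
  proof -
    have "isCont f x"
      using convex_smooth_continuous_on[OF f, of UNIV] by (simp add: continuous_on_eq_continuous_at)
    then show ?thesis using isCont_tendsto_compose sub unfolding o_def by blast
  qed
  moreover have "\<exists>N. \<forall>t\<ge>N. f (p (r t)) \<le> f m + (norm (p 0 - m))\<^sup>2 / (2 * h) * inverse (real (r t))"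
  proof (intro exI allI impI)
    fix t :: nat assume "1 \<le> t"
    then have "1 \<le> r t" using seq_suble[OF r, of t] by linarith
    from rate'[OF m(1) this]
    show "f (p (r t)) \<le> f m + (norm (p 0 - m))\<^sup>2 / (2 * h) * inverse (real (r t))"
      by (simp add: field_simps)
  qed
  ultimately have "f x \<le> f m + (norm (p 0 - m))\<^sup>2 / (2 * h) * 0"
    by (intro LIMSEQ_le)
  then have xm: "f x \<le> f m" by simp
  have "p \<longlonglongrightarrow> x"
  proof -
    \<comment> \<open>Squared distances to \<open>x\<close> decrease and hence converge; the
      subsequence identifies the limit as 0.\<close>
    have "decseq (\<lambda>t. (norm (p t - x))\<^sup>2)" using fejer[OF x0 xm] by (rule decseq_SucI)
    then obtain l where l: "(\<lambda>t. (norm (p t - x))\<^sup>2) \<longlonglongrightarrow> l"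
      by (rule decseq_convergent[of _ 0]) auto
    have "(\<lambda>t. (norm ((p \<circ> r) t - x))\<^sup>2) \<longlonglongrightarrow> (norm (x - x))\<^sup>2"
      by (intro tendsto_intros sub)
    then have "(\<lambda>t. (norm ((p \<circ> r) t - x))\<^sup>2) \<longlonglongrightarrow> 0" by simp
    moreover have "(\<lambda>t. (norm ((p \<circ> r) t - x))\<^sup>2) \<longlonglongrightarrow> l"
      using LIMSEQ_subseq_LIMSEQ[OF l r] by (simp add: o_def)
    ultimately have "l = 0" by (rule LIMSEQ_unique[symmetric])
    with l have "(\<lambda>t. sqrt ((norm (p t - x))\<^sup>2)) \<longlonglongrightarrow> sqrt 0" by (intro tendsto_real_sqrt) simp
    then have "(\<lambda>t. norm (p t - x)) \<longlonglongrightarrow> 0" by simp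
    then show ?thesis by (rule LIM_zero_cancel[OF tendsto_norm_zero_cancel])
  qed
  moreover have "pos_part (x - h *\<^sub>R g x) = x"
  proof -
    let ?x = "pos_part (x - h *\<^sub>R g x)"
    \<comment> \<open>The one-step estimate with \<open>z = x\<close> puts a nonnegative quantity
      below \<open>- (norm (?x - x))\<^sup>2\<close>, so the step does not move.\<close>
    have "f x \<le> f ?x" using xm m(2)[OF pos_part_nonneg] by (rule order_trans)
    then have "0 \<le> 2 * h * (f ?x - f x)" using h by auto
    also have "\<dots> \<le> - (norm (?x - x))\<^sup>2" using projected_step[OF f h x0 refl, of x] by simp
    finally show ?thesis by simp
  qed
  ultimately show thesis using rate'[OF x0] by (rule that)
qed

section \<open>Existence and quadratic growth at minimizers of regularized convex functions\<close>

section \<open>Strongly convex minimization\<close>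

text \<open>\<open>b\<close> is bounded on the unit ball. For longer \<open>y\<close>, convexity on
  the segment from 0 to \<open>y\<close> through \<open>y / norm y\<close> permits at most linear
  decrease, which a quadratic regularizer outweighs.\<close>

lemma convex_on_linear_lower_bound:
  fixes b :: "'a::euclidean_space \<Rightarrow> real"
  assumes b: "convex_on UNIV b"
  obtains A where "0 \<le> A" "\<And>y. - A * (1 + norm y) \<le> b y"
proof -
  have cont: "continuous_on (cball 0 1) b"
    using convex_on_continuous[OF open_UNIV b] continuous_on_subset by blast
  have "bounded (b ` cball 0 1)"
    using compact_continuous_image[OF cont] compact_imp_bounded by auto
  then obtain M where M: "\<And>x. norm x \<le> 1 \<Longrightarrow> \<bar>b x\<bar> \<le> M"
    unfolding bounded_iff by (metis dist_0_norm image_eqI mem_cball real_norm_def)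
  have M0: "0 \<le> M" using M[of 0] by simp
  show thesis
  proof (rule that)
    show "0 \<le> 2 * M" using M0 by simp
    show "- (2 * M) * (1 + norm y) \<le> b y" for y
    proof (cases "norm y \<le> 1")
      case True
      have "- (2 * M) * (1 + norm y) \<le> - (2 * M) * 1"
        using M0 by (intro mult_left_mono_neg) auto
      then show ?thesis using M[OF True] M0 by linarith
    next
      case False
      then have r: "1 < norm y" by simp
      have "b ((1 - 1 / norm y) *\<^sub>R 0 + (1 / norm y) *\<^sub>R y)
          \<le> (1 - 1 / norm y) * b 0 + (1 / norm y) * b y"
        by (rule convex_onD[OF b]) (use r in \<open>auto simp: divide_simps\<close>)
      moreover have "\<bar>b ((1 / norm y) *\<^sub>R y)\<bar> \<le> M" using r by (intro M) simp
      ultimately have "- M \<le> (1 - 1 / norm y) * b 0 + (1 / norm y) * b y" by simp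
      moreover have "(1 - 1 / norm y) * b 0 \<le> 1 * M"
      proof -
        have "(1 - 1 / norm y) * b 0 \<le> (1 - 1 / norm y) * M"
          using M[of 0] r by (intro mult_left_mono) (auto simp: divide_simps)
        also have "\<dots> \<le> 1 * M" using M0 by (intro mult_right_mono) auto
        finally show ?thesis .
      qed
      ultimately have "- (2 * M) \<le> b y / norm y" by simp
      then have "- (2 * M) * norm y \<le> b y" using r by (subst (asm) pos_le_divide_eq) auto
      then show ?thesis using M0 by (simp add: algebra_simps)
    qed
  qed
qed

lemma strongly_convex_minimizer_exists:
  fixes b :: "'a::euclidean_space \<Rightarrow> real"
  assumes b: "convex_on UNIV b" and G: "0 < G" and Y: "closed Y" "Y \<noteq> {}"
  obtains y where "y \<in> Y" "\<And>z. z \<in> Y \<Longrightarrow> b y + G * (norm (y - c))\<^sup>2 \<le> b z + G * (norm (z - c))\<^sup>2"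
proof -
  define F where "F z = b z + G * (norm (z - c))\<^sup>2" for z
  have cont: "continuous_on UNIV F"
    unfolding F_def by (intro continuous_intros convex_on_continuous[OF open_UNIV b])
  obtain A where A: "0 \<le> A" "\<And>y. - A * (1 + norm y) \<le> b y"
    using convex_on_linear_lower_bound[OF b] by blast
  obtain y0 where y0: "y0 \<in> Y" using Y by auto
  let ?S = "Y \<inter> {z. F z \<le> F y0}"
  have "bounded ?S"
  proof (rule boundedI)
    fix z assume z: "z \<in> ?S"
    define r where "r = norm (z - c)"
    define B where "B = F y0 + A * (1 + norm c)"
    have "norm z \<le> r + norm c" unfolding r_def using norm_triangle_sub[of z c] by linarith
    then have "- A * (1 + (r + norm c)) \<le> - A * (1 + norm z)"
      using A(1) by (intro mult_left_mono_neg) auto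
    also have "\<dots> \<le> b z" by (rule A(2))
    finally have "G * r\<^sup>2 - A * r \<le> B"
      using z by (simp add: F_def r_def B_def algebra_simps)
    have r0: "0 \<le> r" by (simp add: r_def)
    \<comment> \<open>Beyond this radius both \<open>G * r - A > \<bar>B\<bar>\<close> and, thanks
      to the summand 1, \<open>r > 1\<close>; their product contradicts the bound by
      \<open>B\<close>.\<close>
    have "r \<le> (A + \<bar>B\<bar>) / G + 1"
    proof (rule ccontr)
      assume *: "\<not> ?thesis"
      then have "A + \<bar>B\<bar> < G * (r - 1)" using G by (simp add: field_simps)
      then have "A + \<bar>B\<bar> < G * r" using G by (simp add: algebra_simps)
      then have "\<bar>B\<bar> < G * r - A" by simp
      moreover have "0 \<le> (A + \<bar>B\<bar>) / G" using A G by simp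
      then have "1 < r" using * by linarith
      ultimately have "\<bar>B\<bar> < (G * r - A) * r"
        by (smt (verit) mult_le_cancel_left1)
      then show False using \<open>G * r\<^sup>2 - A * r \<le> B\<close> by (simp add: power2_eq_square algebra_simps)
    qed
    with \<open>norm z \<le> r + norm c\<close> show "norm z \<le> (A + \<bar>B\<bar>) / G + 1 + norm c" by linarith
  qed
  moreover have "closed ?S" by (intro closed_Int Y closed_Collect_le cont continuous_intros)
  ultimately have "compact ?S" by (simp add: compact_eq_bounded_closed)
  moreover have "?S \<noteq> {}" using y0 by auto
  ultimately have "\<exists>y\<in>?S. \<forall>z\<in>?S. F y \<le> F z"
    by (rule continuous_attains_inf[OF _ _ continuous_on_subset[OF cont subset_UNIV]])
  then obtain y where y: "y \<in> ?S" "\<forall>z\<in>?S. F y \<le> F z" by blast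
  have "F y \<le> F z" if "z \<in> Y" for z
    using y that by (cases "F z \<le> F y0") auto
  then show thesis using that y(1) unfolding F_def by blast
qed

text \<open>The exact gap in the convexity inequality of the squared norm, the source of quadratic
  growth.\<close>

lemma norm_power2_convex_combination:
  fixes u v :: "'a::real_inner"
  shows "(norm ((1 - t) *\<^sub>R u + t *\<^sub>R v))\<^sup>2
    = (1 - t) * (norm u)\<^sup>2 + t * (norm v)\<^sup>2 - t * (1 - t) * (norm (v - u))\<^sup>2"
  unfolding power2_norm_eq_inner
  by (simp add: inner_add_left inner_add_right inner_diff_left inner_diff_right
      inner_commute[of v u]) algebra

text \<open>Compare the minimizer with \<open>(1 - t) *\<^sub>R y + t *\<^sub>R z\<close>, divide by
  \<open>t\<close> and let \<open>t\<close> tend to 0; the factor \<open>1 - t\<close> left on the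
  gap then disappears, so the full weight \<open>G\<close> survives.\<close>

lemma strongly_convex_growth:
  fixes b :: "'a::euclidean_space \<Rightarrow> real"
  assumes b: "convex_on UNIV b" and Y: "convex Y" "y \<in> Y" "z \<in> Y"
    and min: "\<And>z. z \<in> Y \<Longrightarrow> b y + G * (norm (y - c))\<^sup>2 \<le> b z + G * (norm (z - c))\<^sup>2"
  shows "b y + G * (norm (y - c))\<^sup>2 + G * (norm (z - y))\<^sup>2 \<le> b z + G * (norm (z - c))\<^sup>2"
proof -
  define F where "F x = b x + G * (norm (x - c))\<^sup>2" for x
  define N where "N = G * (norm (z - y))\<^sup>2"
  have *: "F y + (1 - t) * N \<le> F z" if t: "0 < t" "t < 1" for t
  proof -
    let ?w = "(1 - t) *\<^sub>R y + t *\<^sub>R z"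
    have w: "?w \<in> Y" using Y t by (intro convexD) auto
    have "?w - c = (1 - t) *\<^sub>R (y - c) + t *\<^sub>R (z - c)" by (simp add: algebra_simps)
    then have nw: "(norm (?w - c))\<^sup>2
        = (1 - t) * (norm (y - c))\<^sup>2 + t * (norm (z - c))\<^sup>2 - t * (1 - t) * (norm (z - y))\<^sup>2"
      by (simp only: norm_power2_convex_combination) simp
    have "b ?w \<le> (1 - t) * b y + t * b z" using t by (intro convex_onD[OF b]) auto
    then have "F ?w \<le> (1 - t) * F y + t * F z - t * (1 - t) * N"
      unfolding F_def nw N_def by (simp add: algebra_simps)
    moreover have "F y \<le> F ?w" using min[OF w] by (simp add: F_def)
    ultimately have "t * (F y + (1 - t) * N) \<le> t * F z" by (simp add: algebra_simps)
    then show ?thesis using t by simp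
  qed
  have "((\<lambda>t. F y + (1 - t) * N) \<longlongrightarrow> F y + (1 - 0) * N) (at_right 0)"
    by (intro tendsto_intros)
  moreover have "eventually (\<lambda>t. F y + (1 - t) * N \<le> F z) (at_right (0::real))"
    unfolding eventually_at_right_field using * by (intro exI[of _ 1]) auto
  ultimately have "F y + (1 - 0) * N \<le> F z"
    by (rule tendsto_upperbound) simp
  then show ?thesis by (simp add: F_def N_def)
qed

section \<open>Jensen and Hoeffding bounds for finite distributions\<close>

section \<open>Log-sum-exp bounds\<close>

lemma sum_exp_pos:
  assumes w: "\<And>i. i \<in> A \<Longrightarrow> 0 \<le> w i" "sum w A = (1::real)"
  shows "0 < (\<Sum>i\<in>A. w i * exp (z i :: real))"
proof -
  \<comment> \<open>A sum over an infinite set is 0 by convention, so total weight 1 forces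
    finiteness.\<close>
  have fin: "finite A" using w(2) by (rule contrapos_pp) simp
  have "\<exists>i\<in>A. w i \<noteq> 0"
  proof (rule ccontr)
    assume "\<not> ?thesis"
    then show False using w(2) by simp
  qed
  then obtain i where i: "i \<in> A" "w i \<noteq> 0" by blast
  then have "0 < w i * exp (z i)" using w(1)[of i] by simp
  with fin i show ?thesis
    by (intro sum_pos2[of A i]) (auto simp: w)
qed

text \<open>Jensen's inequality for \<open>exp\<close>, followed by the logarithm.\<close>

lemma ln_sum_exp_ge:
  assumes w: "\<And>i. i \<in> A \<Longrightarrow> 0 \<le> w i" "sum w A = (1::real)"
  shows "(\<Sum>i\<in>A. w i * z i) \<le> ln (\<Sum>i\<in>A. w i * exp (z i :: real))"
proof -
  have fin: "finite A" using w(2) by (rule contrapos_pp) simp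
  have "A \<noteq> {}" using w(2) by auto
  then have "exp (\<Sum>i\<in>A. w i *\<^sub>R z i) \<le> (\<Sum>i\<in>A. w i * exp (z i))"
    using fin w by (intro convex_on_sum[OF _ _ exp_convex]) auto
  then show ?thesis using sum_exp_pos[OF w] by (simp add: ln_ge_iff)
qed

text \<open>Hoeffding's lemma for the weights \<open>w\<close>: the chord of \<open>exp\<close> over
  the interval reduces the sum to a function of the mean, and a scalar inequality bounds its
  logarithm.\<close>

lemma ln_sum_exp_le_Hoeffding:
  assumes w: "\<And>i. i \<in> A \<Longrightarrow> 0 \<le> w i" "sum w A = (1::real)"
    and z: "\<And>i. i \<in> A \<Longrightarrow> a \<le> z i \<and> z i \<le> b"
  shows "ln (\<Sum>i\<in>A. w i * exp (z i :: real)) \<le> (\<Sum>i\<in>A. w i * z i) + (b - a)\<^sup>2 / 8"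
proof -
  have "A \<noteq> {}" using w(2) by auto
  then have "a \<le> b" using z by force
  show ?thesis
  proof (cases "a = b")
    case True
    then have "z i = a" if "i \<in> A" for i using z[OF that] by linarith
    then show ?thesis using True w(2) by (simp flip: sum_distrib_right)
  next
    case False
    define d where "d = b - a"
    have d: "0 < d" using False \<open>a \<le> b\<close> by (simp add: d_def)
    define m where "m = (\<Sum>i\<in>A. w i * z i)"
    \<comment> \<open>The mass at \<open>b\<close> of the distribution on \<open>a\<close> and
      \<open>b\<close> with mean \<open>m\<close>.\<close>
    define P where "P = (m - a) / d"
    have chord: "exp (z i) \<le> exp a * (1 + (z i - a) / d * (exp d - 1))" if "i \<in> A" for i
    proof -
      define s where "s = (z i - a) / d"
      have s: "s \<le> 1" "0 \<le> s" "z i = a + s * d"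
        using z[OF that] d by (auto simp: d_def s_def)
      then have "exp ((1 - s) *\<^sub>R a + s *\<^sub>R b) \<le> (1 - s) * exp a + s * exp b"
        by (intro convex_onD[OF exp_convex]) auto
      moreover have "(1 - s) *\<^sub>R a + s *\<^sub>R b = z i"
        unfolding s(3) by (simp add: d_def algebra_simps)
      moreover have "exp b = exp a * exp d" by (simp add: d_def flip: exp_add)
      ultimately show ?thesis unfolding s_def[symmetric] by (simp add: algebra_simps)
    qed
    have "m - a = (\<Sum>i\<in>A. w i * (z i - a))"
      by (simp add: m_def right_diff_distrib sum_subtractf w(2) flip: sum_distrib_right)
    then have "0 \<le> m - a" using w z by (auto intro!: sum_nonneg mult_nonneg_nonneg)
    then have P: "0 \<le> P" using d by (simp add: P_def)
    have "(\<Sum>i\<in>A. w i * exp (z i)) \<le> (\<Sum>i\<in>A. w i * (exp a * (1 + (z i - a) / d * (exp d - 1))))"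
      using w chord by (intro sum_mono mult_left_mono) auto
    also have "\<dots> = (\<Sum>i\<in>A. exp a * (w i + w i * (z i - a) * ((exp d - 1) / d)))"
      using d by (intro sum.cong refl) (simp add: field_simps)
    also have "\<dots> = exp a * (1 + P * (exp d - 1))"
      unfolding P_def \<open>m - a = _\<close> sum_distrib_left[symmetric] sum.distrib
        sum_distrib_right[symmetric] w(2) by simp
    finally have le: "(\<Sum>i\<in>A. w i * exp (z i)) \<le> exp a * (1 + P * (exp d - 1))" .
    have pos: "0 < 1 + P * (exp d - 1)" using P d by (intro add_pos_nonneg mult_nonneg_nonneg) auto
    have "ln (\<Sum>i\<in>A. w i * exp (z i)) \<le> ln (exp a * (1 + P * (exp d - 1)))"
      using le sum_exp_pos[OF w] by (rule ln_mono)
    also have "\<dots> = a + ln (1 + P * (exp d - 1))"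
      using pos by (simp add: ln_mult)
    also have "\<dots> \<le> a + (d\<^sup>2 / 8 + d * P)"
      using Hoeffdings_lemma_aux[of d P] P d by simp
    also have "\<dots> = m + (b - a)\<^sup>2 / 8" using d by (simp add: P_def d_def)
    finally show ?thesis by (simp add: m_def)
  qed
qed

text \<open>Turns the range in Hoeffding's bound into a Euclidean norm. The factor 2 is that of
  \<open>(s - t)\<^sup>2 \<le> 2 * (s\<^sup>2 + t\<^sup>2)\<close> at the two extreme
  coordinates.\<close>

lemma vec_range_le_norm:
  fixes d :: "real ^ 'n::finite"
  obtains a b where "\<And>i. a \<le> d $ i \<and> d $ i \<le> b" "(b - a)\<^sup>2 \<le> 2 * (norm d)\<^sup>2"
proof -
  obtain i where i: "d $ i = Min (range (($) d))"
    by (metis Min_in UNIV_not_empty finite finite_imageI imageE image_is_empty)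
  obtain j where j: "d $ j = Max (range (($) d))"
    by (metis Max_in UNIV_not_empty finite finite_imageI imageE image_is_empty)
  show thesis
  proof (rule that)
    show "d $ i \<le> d $ k \<and> d $ k \<le> d $ j" for k by (simp add: i j)
    show "(d $ j - d $ i)\<^sup>2 \<le> 2 * (norm d)\<^sup>2"
    proof (cases "i = j")
      case False
      have "(d $ i)\<^sup>2 + (d $ j)\<^sup>2 = (\<Sum>k\<in>{i, j}. (d $ k)\<^sup>2)" using False by simp
      also have "\<dots> \<le> (\<Sum>k\<in>UNIV. (d $ k)\<^sup>2)" by (intro sum_mono2) auto
      also have "\<dots> = (norm d)\<^sup>2"
        unfolding power2_norm_eq_inner inner_vec_def by (simp add: power2_eq_square)
      finally have le: "(d $ i)\<^sup>2 + (d $ j)\<^sup>2 \<le> (norm d)\<^sup>2" .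
      have "(d $ j - d $ i)\<^sup>2 = 2 * ((d $ i)\<^sup>2 + (d $ j)\<^sup>2) - (d $ j + d $ i)\<^sup>2"
        by (simp add: power2_eq_square algebra_simps)
      also have "\<dots> \<le> 2 * (norm d)\<^sup>2 - 0"
        using le by (intro diff_mono mult_left_mono) auto
      finally show ?thesis by simp
    qed simp
  qed
qed

section \<open>Nested logit: choice probabilities, smoothness and lower bounds of the
  surplus\<close>

section \<open>The nested logit surplus\<close>

definition nest_sum :: "('n::finite) consumer_type \<Rightarrow> nat \<Rightarrow> real ^ 'n \<Rightarrow> real" where
  "nest_sum C l p = (\<Sum>i\<in>nest C l. exp ((utility C $ i - p $ i) / nest_param C l))"

definition total_sum :: "('n::finite) consumer_type \<Rightarrow> real ^ 'n \<Rightarrow> real" where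
  "total_sum C p = (\<Sum>l=1..num_nests C. nest_sum C l p powr nest_param C l)"

definition nest_prob :: "('n::finite) consumer_type \<Rightarrow> real ^ 'n \<Rightarrow> nat \<Rightarrow> real" where
  "nest_prob C p l = nest_sum C l p powr nest_param C l / total_sum C p"

definition nest_choice_prob :: "('n::finite) consumer_type \<Rightarrow> real ^ 'n \<Rightarrow> nat \<Rightarrow> 'n \<Rightarrow> real" where
  "nest_choice_prob C p l i = exp ((utility C $ i - p $ i) / nest_param C l) / nest_sum C l p"

text \<open>The closed form of nested logit demand, matched with \<open>demand\<close> in
  \<open>demand_eq_choice_prob\<close>. For disjoint nests at most one summand is nonzero; summing
  over all nests avoids selecting the nest of \<open>i\<close>.\<close>

definition choice_prob :: "('n::finite) consumer_type \<Rightarrow> real ^ 'n \<Rightarrow> real ^ 'n" where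
  "choice_prob C p =
     (\<chi> i. \<Sum>l=1..num_nests C. if i \<in> nest C l then nest_prob C p l * nest_choice_prob C p l i else 0)"

lemma expected_revenue_eq: "expected_revenue C p = ln (total_sum C p)"
  by (simp add: expected_revenue_def total_sum_def nest_sum_def)

text \<open>The mean of \<open>d\<close> taken in two stages, first within nests and then across
  them, matching the two layers of the surplus.\<close>

lemma choice_prob_inner:
  "choice_prob C p \<bullet> d
    = (\<Sum>l=1..num_nests C. nest_prob C p l * (\<Sum>i\<in>nest C l. nest_choice_prob C p l i * d $ i))"
proof -
  have "choice_prob C p \<bullet> d = (\<Sum>i\<in>UNIV. \<Sum>l=1..num_nests C.
      if i \<in> nest C l then nest_prob C p l * (nest_choice_prob C p l i * d $ i) else 0)"
    unfolding inner_vec_def choice_prob_def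
    by (auto simp: sum_distrib_right intro!: sum.cong)
  also have "\<dots> = (\<Sum>l=1..num_nests C. \<Sum>i\<in>UNIV.
      if i \<in> nest C l then nest_prob C p l * (nest_choice_prob C p l i * d $ i) else 0)"
    by (rule sum.swap)
  also have "\<dots> = (\<Sum>l=1..num_nests C. \<Sum>i\<in>nest C l. nest_prob C p l * (nest_choice_prob C p l i * d $ i))"
    by (rule sum.cong[OF refl]) (simp flip: sum.inter_restrict)
  finally show ?thesis by (simp add: sum_distrib_left)
qed

context
  fixes C :: "('n::finite) consumer_type"
  assumes C: "valid_consumer C"
begin

lemma num_nests_pos: "1 \<le> num_nests C"
  using C by (cases "num_nests C") (auto simp: valid_consumer_def)

lemma nest_param_pos: "l \<in> {1..num_nests C} \<Longrightarrow> 0 < nest_param C l"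
  and nest_param_le_1: "l \<in> {1..num_nests C} \<Longrightarrow> nest_param C l \<le> 1"
  using C by (auto simp: valid_consumer_def)

lemma nest_sum_pos: "l \<in> {1..num_nests C} \<Longrightarrow> 0 < nest_sum C l p"
  using C unfolding valid_consumer_def nest_sum_def by (intro sum_pos) auto

lemma total_sum_pos: "0 < total_sum C p"
  unfolding total_sum_def
proof (rule sum_pos)
  fix l assume "l \<in> {1..num_nests C}"
  from nest_sum_pos[OF this, of p] show "0 < nest_sum C l p powr nest_param C l" by simp
qed (use num_nests_pos in auto)

lemma nest_prob_nonneg: "0 \<le> nest_prob C p l"
  using total_sum_pos[of p] by (simp add: nest_prob_def)

lemma sum_nest_prob: "(\<Sum>l=1..num_nests C. nest_prob C p l) = 1"
  using total_sum_pos[of p]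
  unfolding nest_prob_def sum_divide_distrib[symmetric] total_sum_def[symmetric] by simp

lemma nest_choice_prob_nonneg: "l \<in> {1..num_nests C} \<Longrightarrow> 0 \<le> nest_choice_prob C p l i"
  using nest_sum_pos[of l p] by (simp add: nest_choice_prob_def)

lemma sum_nest_choice_prob: "l \<in> {1..num_nests C} \<Longrightarrow> (\<Sum>i\<in>nest C l. nest_choice_prob C p l i) = 1"
  using nest_sum_pos[of l p]
  by (simp add: nest_choice_prob_def flip: sum_divide_distrib nest_sum_def)

lemma min_nest_param_pos: "0 < min_nest_param C"
  and min_nest_param_le: "l \<in> {1..num_nests C} \<Longrightarrow> min_nest_param C \<le> nest_param C l"
  using num_nests_pos nest_param_pos unfolding min_nest_param_def by auto

lemma min_nest_param_le_1: "min_nest_param C \<le> 1"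
  using min_nest_param_le[of 1] nest_param_le_1[of 1] num_nests_pos by force

text \<open>Factoring out the old sum leaves the moment generating function of the scaled price
  change under the conditional choice probabilities.\<close>

lemma nest_sum_shift:
  assumes l: "l \<in> {1..num_nests C}"
  shows "nest_sum C l (p + d)
    = nest_sum C l p * (\<Sum>i\<in>nest C l. nest_choice_prob C p l i * exp (- d $ i / nest_param C l))"
proof -
  have "exp ((utility C $ i - (p + d) $ i) / nest_param C l)
      = nest_sum C l p * (nest_choice_prob C p l i * exp (- d $ i / nest_param C l))" for i
    using nest_sum_pos[OF l, of p]
    by (simp add: nest_choice_prob_def diff_divide_distrib add_divide_distrib flip: exp_add)
  then show ?thesis by (simp add: nest_sum_def[of C l "p + d"] sum_distrib_left)
qed

text \<open>The same factorization across nests, with the change of each nest's inclusive value as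
  the exponent.\<close>

lemma total_sum_shift:
  "total_sum C (p + d) = total_sum C p * (\<Sum>l=1..num_nests C. nest_prob C p l *
     exp (nest_param C l * ln (\<Sum>i\<in>nest C l. nest_choice_prob C p l i * exp (- d $ i / nest_param C l))))"
proof -
  have "nest_sum C l (p + d) powr nest_param C l = total_sum C p * (nest_prob C p l *
     exp (nest_param C l * ln (\<Sum>i\<in>nest C l. nest_choice_prob C p l i * exp (- d $ i / nest_param C l))))"
    if l: "l \<in> {1..num_nests C}" for l
  proof -
    have "0 < (\<Sum>i\<in>nest C l. nest_choice_prob C p l i * exp (- d $ i / nest_param C l))"
      using nest_choice_prob_nonneg[OF l] sum_nest_choice_prob[OF l] by (intro sum_exp_pos)
    then show ?thesis
      unfolding nest_sum_shift[OF l] nest_prob_def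
      using nest_sum_pos[OF l, of p] total_sum_pos[of p] by (simp add: powr_def ln_mult_pos distrib_left exp_add)
  qed
  then show ?thesis by (simp add: total_sum_def[of C "p + d"] sum_distrib_left)
qed

text \<open>
  Both layers of the nested sum are controlled by Hoeffding's lemma, each contributing
  at most \<open>(norm d)\<^sup>2 / (4 * min_nest_param C)\<close> because the range of \<open>d\<close> is at most
  \<open>sqrt 2 * norm d\<close>.
\<close>

lemma expected_revenue_convex_smooth_choice_prob:
  "convex_smooth (expected_revenue C) (\<lambda>p. - choice_prob C p) (1 / min_nest_param C)"
  unfolding convex_smooth_def
proof (intro allI)
  fix x y :: "real ^ 'n"
  define d where "d = y - x"
  define \<beta> where "\<beta> = min_nest_param C"
  define P where "P = nest_prob C x"
  define q where "q = nest_choice_prob C x"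
  define u where "u l = nest_param C l * ln (\<Sum>i\<in>nest C l. q l i * exp (- d $ i / nest_param C l))" for l
  define m where "m l = (\<Sum>i\<in>nest C l. q l i * d $ i)" for l
  let ?L = "{1..num_nests C}"
  have \<beta>: "0 < \<beta>" "\<beta> \<le> 1" using min_nest_param_pos min_nest_param_le_1 by (auto simp: \<beta>_def)
  have P: "\<And>l. l \<in> ?L \<Longrightarrow> 0 \<le> P l" "sum P ?L = 1"
    using nest_prob_nonneg sum_nest_prob by (auto simp: P_def)
  have q: "0 \<le> q l i" "sum (q l) (nest C l) = 1" if "l \<in> ?L" for l i
    using nest_choice_prob_nonneg[OF that] sum_nest_choice_prob[OF that] by (auto simp: q_def)
  have y: "y = x + d" by (simp add: d_def)
  have E: "expected_revenue C y = expected_revenue C x + ln (\<Sum>l\<in>?L. P l * exp (u l))"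
  proof -
    have "total_sum C y = total_sum C x * (\<Sum>l\<in>?L. P l * exp (u l))"
      unfolding y total_sum_shift P_def q_def u_def ..
    then show ?thesis
      unfolding expected_revenue_eq by (simp only: ln_mult_pos[OF total_sum_pos sum_exp_pos[OF P]])
  qed
  have inner: "(- choice_prob C x) \<bullet> (y - x) = (\<Sum>l\<in>?L. P l * (- m l))"
    by (simp add: choice_prob_inner P_def q_def m_def d_def sum_negf)
  obtain a b where ab: "\<And>i. a \<le> d $ i \<and> d $ i \<le> b" "(b - a)\<^sup>2 \<le> 2 * (norm d)\<^sup>2"
    using vec_range_le_norm by blast
  have mean: "nest_param C l * (\<Sum>i\<in>nest C l. q l i * (- d $ i / nest_param C l)) = - m l"
    if l: "l \<in> ?L" for l
    using nest_param_pos[OF l] by (simp add: m_def sum_distrib_left sum_negf)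
  have u_ge: "- m l \<le> u l" if l: "l \<in> ?L" for l
    unfolding u_def mean[OF l, symmetric]
    by (intro mult_left_mono ln_sum_exp_ge q[OF l] less_imp_le[OF nest_param_pos[OF l]])
  have u_le: "u l \<le> - m l + (norm d)\<^sup>2 / (4 * \<beta>)" if l: "l \<in> ?L" for l
  proof -
    define \<mu> where "\<mu> = nest_param C l"
    have \<mu>: "0 < \<mu>" "\<beta> \<le> \<mu>"
      using nest_param_pos[OF l] min_nest_param_le[OF l] by (auto simp: \<mu>_def \<beta>_def)
    have "ln (\<Sum>i\<in>nest C l. q l i * exp (- d $ i / \<mu>))
        \<le> (\<Sum>i\<in>nest C l. q l i * (- d $ i / \<mu>)) + (- a / \<mu> - - b / \<mu>)\<^sup>2 / 8"
      using \<mu> ab(1) by (intro ln_sum_exp_le_Hoeffding q[OF l]) (auto intro!: divide_right_mono)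
    then have "u l \<le> \<mu> * ((\<Sum>i\<in>nest C l. q l i * (- d $ i / \<mu>)) + (- a / \<mu> - - b / \<mu>)\<^sup>2 / 8)"
      unfolding u_def \<mu>_def[symmetric] using \<mu> by (intro mult_left_mono) auto
    also have "\<dots> = - m l + \<mu> * ((- a / \<mu> - - b / \<mu>)\<^sup>2 / 8)"
      using mean[OF l] by (simp add: \<mu>_def distrib_left)
    \<comment> \<open>The outer factor \<open>\<mu>\<close> cancels one of the two powers of
      \<open>1 / \<mu>\<close> in the squared range.\<close>
    also have "\<mu> * ((- a / \<mu> - - b / \<mu>)\<^sup>2 / 8) = (b - a)\<^sup>2 / (8 * \<mu>)"
      using \<mu> by (simp add: power2_eq_square field_simps)
    also have "\<dots> \<le> (2 * (norm d)\<^sup>2) / (8 * \<beta>)"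
      using \<beta> \<mu> ab(2) by (intro frac_le) auto
    finally show ?thesis by simp
  qed
  have lower: "(\<Sum>l\<in>?L. P l * (- m l)) \<le> ln (\<Sum>l\<in>?L. P l * exp (u l))"
  proof -
    have "(\<Sum>l\<in>?L. P l * (- m l)) \<le> (\<Sum>l\<in>?L. P l * u l)"
      using P u_ge by (intro sum_mono mult_left_mono) auto
    also have "\<dots> \<le> ln (\<Sum>l\<in>?L. P l * exp (u l))" by (rule ln_sum_exp_ge[OF P])
    finally show ?thesis .
  qed
  \<comment> \<open>Nest averages stay within the range of \<open>d\<close>, so the same interval
    serves the outer layer.\<close>
  have m_bounds: "- b \<le> - m l \<and> - m l \<le> - a" if l: "l \<in> ?L" for l
  proof -
    have "(\<Sum>i\<in>nest C l. q l i * a) \<le> m l" "m l \<le> (\<Sum>i\<in>nest C l. q l i * b)"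
      unfolding m_def using ab(1) q[OF l] by (auto intro!: sum_mono mult_left_mono)
    then show ?thesis using q(2)[OF l] by (simp flip: sum_distrib_right)
  qed
  have "ln (\<Sum>l\<in>?L. P l * exp (u l)) \<le> ln (exp ((norm d)\<^sup>2 / (4 * \<beta>)) * (\<Sum>l\<in>?L. P l * exp (- m l)))"
  proof (rule ln_mono)
    have "(\<Sum>l\<in>?L. P l * exp (u l)) \<le> (\<Sum>l\<in>?L. P l * exp (- m l + (norm d)\<^sup>2 / (4 * \<beta>)))"
      using P u_le by (intro sum_mono mult_left_mono) auto
    also have "\<dots> = exp ((norm d)\<^sup>2 / (4 * \<beta>)) * (\<Sum>l\<in>?L. P l * exp (- m l))"
      unfolding exp_add sum_distrib_left by (simp add: mult_ac)
    finally show "(\<Sum>l\<in>?L. P l * exp (u l)) \<le> exp ((norm d)\<^sup>2 / (4 * \<beta>)) * (\<Sum>l\<in>?L. P l * exp (- m l))" .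
  qed (rule sum_exp_pos[OF P])
  also have "\<dots> = (norm d)\<^sup>2 / (4 * \<beta>) + ln (\<Sum>l\<in>?L. P l * exp (- m l))"
    using sum_exp_pos[OF P, of "\<lambda>l. - m l"] by (simp add: ln_mult)
  also have "\<dots> \<le> (norm d)\<^sup>2 / (4 * \<beta>) + ((\<Sum>l\<in>?L. P l * (- m l)) + (- a - - b)\<^sup>2 / 8)"
    using m_bounds by (intro add_left_mono ln_sum_exp_le_Hoeffding P) auto
  \<comment> \<open>Across nests no \<open>1 / \<beta>\<close> arises;
    \<open>\<beta> \<le> 1\<close> allows inserting it.\<close>
  also have "(- a - - b)\<^sup>2 / 8 \<le> (norm d)\<^sup>2 / (4 * \<beta>)"
  proof -
    have "(- a - - b)\<^sup>2 / 8 \<le> (2 * (norm d)\<^sup>2) / (8 * \<beta>)"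
      using ab(2) \<beta> by (intro frac_le) auto
    then show ?thesis by simp
  qed
  \<comment> \<open>The two contributions of \<open>1 / (4 * \<beta>)\<close> add up to
    \<open>1 / (2 * \<beta>)\<close>.\<close>
  finally have upper: "ln (\<Sum>l\<in>?L. P l * exp (u l))
      \<le> (\<Sum>l\<in>?L. P l * (- m l)) + 1 / \<beta> / 2 * (norm d)\<^sup>2"
    using \<beta> by (simp add: field_simps)
  show "expected_revenue C x + - choice_prob C x \<bullet> (y - x) \<le> expected_revenue C y \<and>
      expected_revenue C y \<le> expected_revenue C x + - choice_prob C x \<bullet> (y - x)
        + 1 / min_nest_param C / 2 * (norm (y - x))\<^sup>2"
    unfolding E inner using lower upper unfolding d_def \<beta>_def by (intro conjI; linarith)
qed

lemma demand_eq_choice_prob: "demand C p = choice_prob C p"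
  unfolding demand_def
  using gradient_eqI[OF convex_smooth_GDERIV[OF expected_revenue_convex_smooth_choice_prob]] by simp

lemma expected_revenue_convex_smooth:
  "convex_smooth (expected_revenue C) (\<lambda>p. - demand C p) (1 / min_nest_param C)"
  using expected_revenue_convex_smooth_choice_prob by (simp add: demand_eq_choice_prob)

text \<open>Keep a single product in the nested sum; the power \<open>nest_param C l\<close> undoes
  the division in the exponent.\<close>

lemma expected_revenue_ge_utility: "utility C $ i - p $ i \<le> expected_revenue C p"
proof -
  obtain l where l: "l \<in> {1..num_nests C}" "i \<in> nest C l"
    using C unfolding valid_consumer_def by blast
  have "exp ((utility C $ i - p $ i) / nest_param C l) \<le> nest_sum C l p"
    unfolding nest_sum_def using l(2) by (intro member_le_sum) auto
  then have "exp ((utility C $ i - p $ i) / nest_param C l) powr nest_param C l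
      \<le> nest_sum C l p powr nest_param C l"
    using nest_param_pos[OF l(1)] by (intro powr_mono2) auto
  also have "\<dots> \<le> total_sum C p"
    unfolding total_sum_def using l(1) by (intro member_le_sum) auto
  also have "exp ((utility C $ i - p $ i) / nest_param C l) powr nest_param C l
      = exp (utility C $ i - p $ i)"
    using nest_param_pos[OF l(1)] by (simp add: powr_def)
  finally show ?thesis
    unfolding expected_revenue_eq using total_sum_pos[of p] by (simp add: ln_ge_iff)
qed

text \<open>Averaging the bound for single products with weights \<open>q\<close> gives the demand
  half of the coercivity estimate.\<close>

lemma expected_revenue_lower_bound:
  assumes q: "q \<in> prob_simplex"
  shows "q \<bullet> utility C - q \<bullet> p \<le> expected_revenue C p"
proof -
  have "q \<bullet> utility C - q \<bullet> p = (\<Sum>i\<in>UNIV. q $ i * (utility C $ i - p $ i))"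
    by (simp add: inner_vec_def right_diff_distrib sum_subtractf)
  also have "\<dots> \<le> (\<Sum>i\<in>UNIV. q $ i * expected_revenue C p)"
    using q expected_revenue_ge_utility
    by (intro sum_mono mult_left_mono) (auto simp: prob_simplex_def)
  also have "\<dots> = expected_revenue C p"
    using q by (simp add: prob_simplex_def flip: sum_distrib_right)
  finally show ?thesis .
qed

end

section \<open>Well-defined supply and smoothness of the maximal profit\<close>

section \<open>The profit function\<close>

lemma norm_diff_scaleR_power2:
  fixes u v :: "'a::real_inner"
  shows "(norm (u - c *\<^sub>R v))\<^sup>2 = (norm u)\<^sup>2 - 2 * c * (u \<bullet> v) + c\<^sup>2 * (norm v)\<^sup>2"
  unfolding power2_norm_eq_inner
  by (simp add: inner_diff_left inner_diff_right inner_commute[of v u] power2_eq_square right_diff_distrib)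

context
  fixes S :: "('n::finite) supplier"
  assumes S: "valid_supplier S" and nonempty: "capacity_set S \<noteq> {}"
begin

text \<open>Maximizing profit is minimizing a convex function plus the quadratic regularizer.
  Quadratic growth also yields uniqueness, which the definite description in
  \<open>optimal_supply\<close> requires.\<close>

lemma optimal_supply_growth:
  shows optimal_supply_in: "optimal_supply S p \<in> capacity_set S"
    and optimal_supply_optimal: "z \<in> capacity_set S \<Longrightarrow>
      p \<bullet> z - cost S z + reg_weight S * (norm (z - optimal_supply S p))\<^sup>2
        \<le> p \<bullet> optimal_supply S p - cost S (optimal_supply S p)"
proof -
  let ?Y = "capacity_set S" and ?G = "reg_weight S"
  define b where "b y = base_cost S y + (- p) \<bullet> y" for y
  have F: "b y + ?G * (norm (y - reg_center S))\<^sup>2 = - (p \<bullet> y - cost S y)" for y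
    by (simp add: b_def cost_def)
  have Y: "closed ?Y" "convex ?Y" and G: "0 < ?G" and base: "convex_on UNIV (base_cost S)"
    using S by (auto simp: valid_supplier_def)
  have "convex_on UNIV (\<lambda>y. (- p) \<bullet> y)"
    by (intro convex_onI) (auto simp: inner_add_right)
  then have b: "convex_on UNIV b" unfolding b_def by (intro convex_on_add base)
  obtain y where y: "y \<in> ?Y"
    "\<And>z. z \<in> ?Y \<Longrightarrow> b y + ?G * (norm (y - reg_center S))\<^sup>2 \<le> b z + ?G * (norm (z - reg_center S))\<^sup>2"
    using strongly_convex_minimizer_exists[OF b G Y(1) nonempty] by blast
  have max: "p \<bullet> z - cost S z \<le> p \<bullet> y - cost S y" if "z \<in> ?Y" for z
    using y(2)[OF that] unfolding F by linarith
  have growth: "p \<bullet> z - cost S z + ?G * (norm (z - y))\<^sup>2 \<le> p \<bullet> y - cost S y" if "z \<in> ?Y" for z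
    using strongly_convex_growth[OF b Y(2) y(1) that y(2)] unfolding F by simp
  have "optimal_supply S p = y"
    unfolding optimal_supply_def
  proof (rule the_equality)
    show "is_arg_max (\<lambda>y. p \<bullet> y - cost S y) (\<lambda>y. y \<in> ?Y) y"
      using y(1) max by (auto simp: is_arg_max_def not_less)
  next
    fix y' assume y': "is_arg_max (\<lambda>y. p \<bullet> y - cost S y) (\<lambda>y. y \<in> ?Y) y'"
    then have "y' \<in> ?Y" "p \<bullet> y - cost S y \<le> p \<bullet> y' - cost S y'"
      using y(1) unfolding is_arg_max_def by (auto simp: not_less)
    with growth[of y'] have "?G * (norm (y' - y))\<^sup>2 \<le> 0" by simp
    then show "y' = y" using G by (simp add: mult_le_0_iff)
  qed
  with y(1) growth show "optimal_supply S p \<in> ?Y"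
    "z \<in> ?Y \<Longrightarrow> p \<bullet> z - cost S z + ?G * (norm (z - optimal_supply S p))\<^sup>2
        \<le> p \<bullet> optimal_supply S p - cost S (optimal_supply S p)" by auto
qed

lemma reg_weight_pos: "0 < reg_weight S"
  using S by (simp add: valid_supplier_def)

lemma optimal_supply_max:
  assumes "z \<in> capacity_set S"
  shows "p \<bullet> z - cost S z \<le> p \<bullet> optimal_supply S p - cost S (optimal_supply S p)"
proof -
  have "0 \<le> reg_weight S * (norm (z - optimal_supply S p))\<^sup>2" using reg_weight_pos by simp
  then show ?thesis using optimal_supply_optimal[OF assms, of p] by linarith
qed

lemma profit_eq: "profit S p = p \<bullet> optimal_supply S p - cost S (optimal_supply S p)"
  unfolding profit_def
  by (rule Greatest_equality) (use optimal_supply_in optimal_supply_max in auto)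

text \<open>Lower bound: the supply at \<open>p\<close> stays feasible at \<open>q\<close>. Upper
  bound: at \<open>p\<close>, the supply for \<open>q\<close> loses at least its squared distance
  from the optimum times \<open>reg_weight S\<close>, which offsets the cross term by Young's
  inequality.\<close>

lemma profit_convex_smooth: "convex_smooth (profit S) (optimal_supply S) (1 / reg_weight S)"
  unfolding convex_smooth_def
proof (intro allI conjI)
  fix p q :: "real ^ 'n"
  let ?G = "reg_weight S" and ?y = "optimal_supply S p" and ?z = "optimal_supply S q"
  show "profit S p + ?y \<bullet> (q - p) \<le> profit S q"
    using optimal_supply_max[OF optimal_supply_in, of q p] unfolding profit_eq
    by (simp add: inner_diff_right inner_commute)
  have "(q - p) \<bullet> (?z - ?y) - ?G * (norm (?z - ?y))\<^sup>2 \<le> 1 / ?G / 2 * (norm (q - p))\<^sup>2"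
  proof -
    \<comment> \<open>The completed square by itself gives the constant \<open>1 / (4 * ?G)\<close>;
      the second summand raises it to the stated \<open>1 / (2 * ?G)\<close>.\<close>
    have "0 \<le> (1 / (2 * ?G)) * (norm (q - p - (2 * ?G) *\<^sub>R (?z - ?y)))\<^sup>2 / 2
        + 1 / (4 * ?G) * (norm (q - p))\<^sup>2"
      using reg_weight_pos by simp
    also have "(norm (q - p - (2 * ?G) *\<^sub>R (?z - ?y)))\<^sup>2
        = (norm (q - p))\<^sup>2 - 4 * ?G * ((q - p) \<bullet> (?z - ?y)) + 4 * ?G * (?G * (norm (?z - ?y))\<^sup>2)"
      unfolding norm_diff_scaleR_power2 by (simp add: power2_eq_square)
    finally show ?thesis using reg_weight_pos by (simp add: field_simps)
  qed
  moreover have "(q - p) \<bullet> ?z = (q - p) \<bullet> ?y + (q - p) \<bullet> (?z - ?y)"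
    by (simp add: inner_diff_right)
  moreover have "profit S q = p \<bullet> ?z - cost S ?z + (q - p) \<bullet> ?z"
    unfolding profit_eq by (simp add: inner_diff_left)
  moreover have "p \<bullet> ?z - cost S ?z + ?G * (norm (?z - ?y))\<^sup>2 \<le> profit S p"
    unfolding profit_eq by (rule optimal_supply_optimal[OF optimal_supply_in])
  ultimately show "profit S q \<le> profit S p + ?y \<bullet> (q - p) + 1 / ?G / 2 * (norm (q - p))\<^sup>2"
    by (simp add: inner_commute)
qed

end

section \<open>Assembly: smoothness and coercivity of total expected revenue, then the
  equilibrium\<close>

section \<open>Convergence of the price adjustment\<close>

text \<open>The smoothness constant is the denominator in the bound on the step size
  \<open>h\<close>.\<close>

lemma total_expected_revenue_convex_smooth:
  fixes S :: "nat \<Rightarrow> ('n::finite) supplier"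
  assumes S: "\<And>k. k \<in> {1..K} \<Longrightarrow> valid_supplier (S k) \<and> capacity_set (S k) \<noteq> {}"
    and C: "\<And>j. j \<in> {1..J} \<Longrightarrow> valid_consumer (C j)"
  shows "convex_smooth (total_expected_revenue K S J C) (excess_supply K S J C)
    ((\<Sum>j=1..J. population (C j) / min_nest_param (C j)) + (\<Sum>k=1..K. 1 / reg_weight (S k)))"
proof -
  have pop: "0 \<le> population (C j)" if "j \<in> {1..J}" for j
    using C[OF that] by (simp add: valid_consumer_def)
  have "convex_smooth (\<lambda>p. \<Sum>k=1..K. profit (S k) p) (\<lambda>p. \<Sum>k=1..K. optimal_supply (S k) p)
      (\<Sum>k=1..K. 1 / reg_weight (S k))"
    using S by (intro convex_smooth_sum profit_convex_smooth) auto
  moreover have "convex_smooth (\<lambda>p. \<Sum>j=1..J. population (C j) * expected_revenue (C j) p)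
      (\<lambda>p. \<Sum>j=1..J. population (C j) *\<^sub>R - demand (C j) p)
      (\<Sum>j=1..J. population (C j) * (1 / min_nest_param (C j)))"
    using C pop by (intro convex_smooth_sum convex_smooth_cmult expected_revenue_convex_smooth) auto
  ultimately have "convex_smooth
      (\<lambda>p. (\<Sum>k=1..K. profit (S k) p) + (\<Sum>j=1..J. population (C j) * expected_revenue (C j) p))
      (\<lambda>p. (\<Sum>k=1..K. optimal_supply (S k) p) + (\<Sum>j=1..J. population (C j) *\<^sub>R - demand (C j) p))
      ((\<Sum>k=1..K. 1 / reg_weight (S k)) + (\<Sum>j=1..J. population (C j) * (1 / min_nest_param (C j))))"
    by (rule convex_smooth_add)
  then show ?thesis
    unfolding total_expected_revenue_def excess_supply_def
    by (simp add: sum_negf add.commute)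
qed

text \<open>Weak duality: test every profit maximum with \<open>y k\<close> and every surplus with
  \<open>q j\<close>. The slope in \<open>p\<close> is the resulting supply gap.\<close>

lemma total_expected_revenue_lower_bound:
  fixes S :: "nat \<Rightarrow> ('n::finite) supplier"
  assumes S: "\<And>k. k \<in> {1..K} \<Longrightarrow> valid_supplier (S k)"
    and C: "\<And>j. j \<in> {1..J} \<Longrightarrow> valid_consumer (C j)"
    and y: "\<And>k. k \<in> {1..K} \<Longrightarrow> y k \<in> capacity_set (S k)"
    and q: "\<And>j. j \<in> {1..J} \<Longrightarrow> q j \<in> prob_simplex"
  shows "(\<Sum>j=1..J. population (C j) * (q j \<bullet> utility (C j))) - (\<Sum>k=1..K. cost (S k) (y k))
      + p \<bullet> ((\<Sum>k=1..K. y k) - (\<Sum>j=1..J. population (C j) *\<^sub>R q j))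
    \<le> total_expected_revenue K S J C p"
proof -
  have "(\<Sum>k=1..K. p \<bullet> y k - cost (S k) (y k)) \<le> (\<Sum>k=1..K. profit (S k) p)"
  proof (rule sum_mono)
    fix k assume k: "k \<in> {1..K}"
    then have "capacity_set (S k) \<noteq> {}" using y by blast
    then show "p \<bullet> y k - cost (S k) (y k) \<le> profit (S k) p"
      using S[OF k] y[OF k] by (simp add: profit_eq optimal_supply_max)
  qed
  moreover have pop: "0 \<le> population (C j)" if "j \<in> {1..J}" for j
    using C[OF that] by (simp add: valid_consumer_def)
  have "(\<Sum>j=1..J. population (C j) * (q j \<bullet> utility (C j) - q j \<bullet> p))
      \<le> (\<Sum>j=1..J. population (C j) * expected_revenue (C j) p)"
    using C pop by (intro sum_mono mult_left_mono expected_revenue_lower_bound q) auto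
  ultimately show ?thesis
    unfolding total_expected_revenue_def
    by (simp add: inner_diff_right inner_sum_right sum_subtractf right_diff_distrib inner_commute)
qed

theorem theorem4p3:
  fixes K J :: nat
    and S :: "nat \<Rightarrow> ('n::finite) supplier"
    and C :: "nat \<Rightarrow> 'n consumer_type"
    and ybar qbar :: "nat \<Rightarrow> real ^ 'n"
    and p :: "nat \<Rightarrow> real ^ 'n"
    and h :: real
  assumes "\<And>k. k \<in> {1..K} \<Longrightarrow> valid_supplier (S k)"
    and "\<And>j. j \<in> {1..J} \<Longrightarrow> valid_consumer (C j)"
    and "\<And>k. k \<in> {1..K} \<Longrightarrow> ybar k \<in> capacity_set (S k)"
    and "\<And>j. j \<in> {1..J} \<Longrightarrow> qbar j \<in> prob_simplex"
    and "\<And>i. (\<Sum>k=1..K. ybar k) $ i > (\<Sum>j=1..J. population (C j) *\<^sub>R qbar j) $ i"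
    and "0 \<le> p 0"
    and "0 < h"
    and "h \<le> 1 / ((\<Sum>j=1..J. population (C j) / min_nest_param (C j))
                    + (\<Sum>k=1..K. 1 / reg_weight (S k)))"
    and "\<And>t. p (Suc t) = pos_part (p t - h *\<^sub>R excess_supply K S J C (p t))"
  shows "\<exists>pstar. equilibrium_price K S J C pstar \<and> p \<longlonglongrightarrow> pstar \<and>
           (\<forall>t\<ge>1. total_expected_revenue K S J C (p t) - total_expected_revenue K S J C pstar
                     \<le> (norm (p 0 - pstar))\<^sup>2 / (2 * real t * h))"
proof -
  let ?f = "total_expected_revenue K S J C" and ?g = "excess_supply K S J C"
  define L where "L = (\<Sum>j=1..J. population (C j) / min_nest_param (C j))
                    + (\<Sum>k=1..K. 1 / reg_weight (S k))"
  \<comment> \<open>\<open>valid_supplier\<close> does not include nonemptiness; \<open>ybar\<close>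
    supplies it.\<close>
  have "valid_supplier (S k) \<and> capacity_set (S k) \<noteq> {}" if "k \<in> {1..K}" for k
    using assms(1,3) that by blast
  then have f: "convex_smooth ?f ?g L"
    unfolding L_def using assms(2) by (rule total_expected_revenue_convex_smooth)
  have h: "h \<le> 1 / L" using assms(8) by (simp add: L_def)
  \<comment> \<open>Since \<open>1 / 0 = 0\<close>, the two bounds on \<open>h\<close> rule out
    \<open>L = 0\<close>, the value when \<open>K = J = 0\<close>.\<close>
  with \<open>0 < h\<close> have "0 < 1 / L" by linarith
  then have "0 < L" by simp
  then have Lh: "L * h \<le> 1" using h by (simp add: field_simps)
  \<comment> \<open>The Slater gap provides the positive slopes for
    \<open>orthant_minimizer_exists\<close>.\<close>
  have "0 < ((\<Sum>k=1..K. ybar k) - (\<Sum>j=1..J. population (C j) *\<^sub>R qbar j)) $ i" for i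
    using assms(5)[of i] unfolding vector_minus_component by linarith
  from orthant_minimizer_exists[OF convex_smooth_continuous_on[OF f]
      total_expected_revenue_lower_bound[OF assms(1,2,3,4)] this]
  obtain m where "0 \<le> m" "\<And>z. 0 \<le> z \<Longrightarrow> ?f m \<le> ?f z" by blast
  from projected_gradient_descent[OF f \<open>0 < h\<close> Lh assms(6,9) this]
  obtain x where x: "p \<longlonglongrightarrow> x" "pos_part (x - h *\<^sub>R ?g x) = x"
    "\<And>t. 1 \<le> t \<Longrightarrow> ?f (p t) - ?f x \<le> (norm (p 0 - x))\<^sup>2 / (2 * real t * h)"
    by blast
  have "0 \<le> x" using x(2) pos_part_nonneg by metis
  then have "equilibrium_price K S J C x"
    using pos_part_fixed_point_complementarity[OF \<open>0 < h\<close> x(2)]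
    by (simp add: equilibrium_price_def)
  with x show ?thesis by blast
qed

end
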